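(* Assume that $\mathrm{cov}(\mathfrak{D}_{\mathrm{fin}})<\mathfrak{d}$. Let $X$ be a Tychonoff space such that for each $Y\subseteq X$, $C_p(Y)$ has the Pytkeev property. Then $X$ satisfies $\mathsf{U}_{fin}(\mathcal{O},\Gamma)$ as well as $\mathsf{S}_1(\mathcal{O},\mathcal{O})$.
   Context: For $f,g\in\mathbb{N}^{\mathbb{N}}$, $f\le^* g$ means $f(n)\le g(n)$ for all but finitely many $n$. $D\subseteq\mathbb{N}^{\mathbb{N}}$ is dominating if for each $f\in\mathbb{N}^{\mathbb{N}}$ there is $g\in D$ with $f\le^* g$; $\mathfrak{d}$ is the minimal cardinality of a dominating subset of $\mathbb{N}^{\mathbb{N}}$. $D\subseteq\mathbb{N}^{\mathbb{N}}$ is finitely dominating if its closure under pointwise maxima of finite subsets is dominating. $\mathfrak{D}_{\mathrm{fin}}$ is the family of all subsets of $\mathbb{N}^{\mathbb{N}}$ which are not finitely dominating, and $\mathrm{cov}(\mathfrak{D}_{\mathrm{fin}})=\min\{|\mathcal{F}| : \mathcal{F}\subseteq\mathfrak{D}_{\mathrm{fin}}\text{ and }\bigcup\mathcal{F}=\mathbb{N}^{\mathbb{N}}\}$. Each $Y\subseteq X$ carries the subspace topology. $C_p(Y)$ is the set of all continuous real-valued functions on $Y$ with the topology of pointwise convergence; $\mathbf{0}$ is the constant zero function. $C_p(Y)$ has the Pytkeev property if for each $A\subseteq C_p(Y)$ with $\mathbf{0}\in\overline{A}\setminus A$, there are infinite sets $A_1,A_2,\dots\subseteq A$ such that each neighborhood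 of $\mathbf{0}$ contains some $A_n$. A family $\mathcal{U}$ of subsets of $X$ is a cover of $X$ if $X=\bigcup\mathcal{U}$ but $X\notin\mathcal{U}$. A cover $\mathcal{U}$ of $X$ is a $\gamma$-cover if it is infinite and for each $x\in X$, $x\in U$ for all but finitely many $U\in\mathcal{U}$. $\mathcal{O}$ and $\Gamma$ denote the collections of all open covers and open $\gamma$-covers of $X$, respectively. For collections $\mathscr{A},\mathscr{B}$ of covers of $X$: $\mathsf{S}_1(\mathscr{A},\mathscr{B})$: for all $\mathcal{U}_1,\mathcal{U}_2,\dots\in\mathscr{A}$ there are $U_1\in\mathcal{U}_1,U_2\in\mathcal{U}_2,\dots$ such that $\{U_1,U_2,\dots\}\in\mathscr{B}$. $\mathsf{U}_{fin}(\mathscr{A},\mathscr{B})$: for all $\mathcal{U}_1,\mathcal{U}_2,\dots\in\mathscr{A}$ there are finite $\mathcal{F}_1\subseteq\mathcal{U}_1,\mathcal{F}_2\subseteq\mathcal{U}_2,\dots$ such that $\{\bigcup\mathcal{F}_1,\bigcup\mathcal{F}_2,\dots\}\in\mathscr{B}$.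
   Formalization: X is assumed nonempty (S_1(O,O) fails for empty X), and U_fin(O,Γ) is restricted to sequences of open covers having no finite subcover, since as literally defined it fails for every Hausdorff X with at least two points (take a constant sequence of a finite cover). *)

theory Defs
  imports "HOL-Analysis.Analysis"
begin

unbundle cardinal_syntax

text \<open>
  The least cardinality of a member of a family of sets, as a cardinal in the sense of
  \<^const>\<open>card_of\<close>.  It is meaningful only for nonempty families; see \<open>min_card_props\<close>.
\<close>
definition min_card :: "'a set set \<Rightarrow> 'a rel" where
  "min_card \<A> = |SOME A. A \<in> \<A> \<and> (\<forall>B\<in>\<A>. |A| \<le>o |B| )|"

lemma min_card_props:
  assumes "\<A> \<noteq> {}"
  shows "\<exists>A\<in>\<A>. min_card \<A> = |A|" and "\<forall>B\<in>\<A>. min_card \<A> \<le>o |B|"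
proof -
  have "\<exists>r\<in>card_of ` \<A>. \<forall>r'\<in>card_of ` \<A>. r \<le>o r'"
  proof (rule exists_minim_Card_order)
    show "card_of ` \<A> \<noteq> {}" using assms by simp
    show "\<forall>r\<in>card_of ` \<A>. Card_order r" by (rule ballI, erule imageE, hypsubst, rule card_of_Card_order)
  qed
  then have ex: "\<exists>A. A \<in> \<A> \<and> (\<forall>B\<in>\<A>. |A| \<le>o |B| )"
    by (simp add: Bex_def)
  define A where "A = (SOME A. A \<in> \<A> \<and> (\<forall>B\<in>\<A>. |A| \<le>o |B| ))"
  have A: "A \<in> \<A> \<and> (\<forall>B\<in>\<A>. |A| \<le>o |B| )"
    unfolding A_def by (rule someI_ex[OF ex])
  have card: "min_card \<A> = |A|"
    by (simp only: min_card_def A_def)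
  show "\<exists>A\<in>\<A>. min_card \<A> = |A|"
    using A card by (intro bexI[of _ A]) simp_all
  show "\<forall>B\<in>\<A>. min_card \<A> \<le>o |B|"
    unfolding card using A by (rule conjunct2)
qed

definition le_star :: "(nat \<Rightarrow> nat) \<Rightarrow> (nat \<Rightarrow> nat) \<Rightarrow> bool"  (infix "\<le>\<^sup>*" 50) where
  "f \<le>\<^sup>* g \<longleftrightarrow> finite {n. \<not> f n \<le> g n}"

definition dominating :: "(nat \<Rightarrow> nat) set \<Rightarrow> bool" where
  "dominating D \<longleftrightarrow> (\<forall>f. \<exists>g\<in>D. f \<le>\<^sup>* g)"

definition cardinal_d :: "(nat \<Rightarrow> nat) rel" where
  "cardinal_d = min_card {D. dominating D}"

definition maxfin :: "(nat \<Rightarrow> nat) set \<Rightarrow> (nat \<Rightarrow> nat) set" where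
  "maxfin D = {(\<lambda>n. Max ((\<lambda>f. f n) ` F)) | F. finite F \<and> F \<noteq> {} \<and> F \<subseteq> D}"

definition finitely_dominating :: "(nat \<Rightarrow> nat) set \<Rightarrow> bool" where
  "finitely_dominating D \<longleftrightarrow> dominating (maxfin D)"

definition D_fin :: "(nat \<Rightarrow> nat) set set" where
  "D_fin = {D. \<not> finitely_dominating D}"

definition cov_D_fin :: "(nat \<Rightarrow> nat) set rel" where
  "cov_D_fin = min_card {\<F>. \<F> \<subseteq> D_fin \<and> \<Union>\<F> = UNIV}"

lemma dominating_families_nonempty: "{D. dominating D} \<noteq> {}"
proof -
  have "dominating UNIV"
    unfolding dominating_def le_star_def
    by (rule allI, rule_tac x = f in bexI) simp_all
  then show ?thesis by blast
qed

lemma D_fin_covers_nonempty: "{\<F>. \<F> \<subseteq> D_fin \<and> \<Union>\<F> = UNIV} \<noteq> {}"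
proof -
  have "{f} \<in> D_fin" for f
  proof -
    have "maxfin {f} \<subseteq> {f}"
    proof
      fix g assume "g \<in> maxfin {f}"
      then obtain F where g: "g = (\<lambda>n. Max ((\<lambda>f. f n) ` F))" and "F \<noteq> {}" "F \<subseteq> {f}"
        unfolding maxfin_def by blast
      then have "F = {f}" by blast
      then show "g \<in> {f}" by (simp add: g)
    qed
    moreover have "\<not> (\<lambda>n. Suc (f n)) \<le>\<^sup>* f"
      by (simp add: le_star_def)
    ultimately have "\<not> dominating (maxfin {f})"
      unfolding dominating_def by blast
    then show ?thesis by (simp add: D_fin_def finitely_dominating_def)
  qed
  then have "range (\<lambda>f. {f}) \<in> {\<F>. \<F> \<subseteq> D_fin \<and> \<Union>\<F> = UNIV}"
    by (simp add: image_subset_iff)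
  then show ?thesis by (metis empty_iff)
qed

definition Tychonoff_space :: "'a topology \<Rightarrow> bool" where
  "Tychonoff_space X \<longleftrightarrow> completely_regular_space X \<and> Hausdorff_space X"

text \<open>
  Points of the product topology are functions that are \<^const>\<open>undefined\<close> outside
  \<^term>\<open>topspace Y\<close>, so that each continuous function on \<^term>\<open>Y\<close> is represented exactly once.
\<close>
definition Cp :: "'a topology \<Rightarrow> ('a \<Rightarrow> real) topology" where
  "Cp Y = subtopology (product_topology (\<lambda>_. euclideanreal) (topspace Y))
            {f. continuous_map Y euclideanreal f}"

definition Cp_zero :: "'a topology \<Rightarrow> 'a \<Rightarrow> real" where
  "Cp_zero Y = (\<lambda>x\<in>topspace Y. 0)"

lemma topspace_Cp:
  "topspace (Cp Y) = {f \<in> extensional (topspace Y). continuous_map Y euclideanreal f}"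
  by (auto simp: Cp_def PiE_def)

lemma Cp_zero_in_topspace: "Cp_zero Y \<in> topspace (Cp Y)"
proof -
  have "continuous_map Y euclideanreal (Cp_zero Y)"
    by (rule continuous_map_eq[where f = "\<lambda>_. 0"]) (auto simp: Cp_zero_def)
  then show ?thesis by (simp add: topspace_Cp Cp_zero_def)
qed

definition Cp_Pytkeev :: "'a topology \<Rightarrow> bool" where
  "Cp_Pytkeev Y \<longleftrightarrow>
     (\<forall>A \<subseteq> topspace (Cp Y). Cp_zero Y \<in> (Cp Y closure_of A) - A \<longrightarrow>
        (\<exists>B :: nat \<Rightarrow> ('a \<Rightarrow> real) set.
           (\<forall>n. infinite (B n) \<and> B n \<subseteq> A) \<and>
           (\<forall>W. openin (Cp Y) W \<and> Cp_zero Y \<in> W \<longrightarrow> (\<exists>n. B n \<subseteq> W))))"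

definition is_cover :: "'a topology \<Rightarrow> 'a set set \<Rightarrow> bool" where
  "is_cover X \<U> \<longleftrightarrow> \<Union>\<U> = topspace X \<and> topspace X \<notin> \<U>"

definition open_covers :: "'a topology \<Rightarrow> 'a set set set" where
  "open_covers X = {\<U>. is_cover X \<U> \<and> (\<forall>U\<in>\<U>. openin X U)}"

definition gamma_covers :: "'a topology \<Rightarrow> 'a set set set" where
  "gamma_covers X =
     {\<U> \<in> open_covers X. infinite \<U> \<and> (\<forall>x\<in>topspace X. finite {U \<in> \<U>. x \<notin> U})}"

definition S1 :: "'a set set set \<Rightarrow> 'a set set set \<Rightarrow> bool" where
  "S1 \<AA> \<BB> \<longleftrightarrow>
     (\<forall>\<U> :: nat \<Rightarrow> 'a set set. (\<forall>n. \<U> n \<in> \<AA>) \<longrightarrow>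
        (\<exists>U. (\<forall>n. U n \<in> \<U> n) \<and> range U \<in> \<BB>))"

text \<open>
  As usual for this selection principle, only covers without a finite subcover are considered.
  The restriction is needed: for the constant sequence of a finite cover there are only finitely
  many sets \<open>\<Union>(F n)\<close>, so they never form a \<open>\<gamma>\<close>-cover.
\<close>
definition Ufin :: "'a topology \<Rightarrow> 'a set set set \<Rightarrow> 'a set set set \<Rightarrow> bool" where
  "Ufin X \<AA> \<BB> \<longleftrightarrow>
     (\<forall>\<U> :: nat \<Rightarrow> 'a set set.
        (\<forall>n. \<U> n \<in> \<AA> \<and> \<not> (\<exists>F \<subseteq> \<U> n. finite F \<and> \<Union>F = topspace X)) \<longrightarrow>
        (\<exists>F. (\<forall>n. finite (F n) \<and> F n \<subseteq> \<U> n) \<and> range (\<lambda>n. \<Union>(F n)) \<in> \<BB>))"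

end

theory Submission
  imports Defs
begin

text \<open>
  The Pytkeev property of \<open>C\<^sub>p(X)\<close> makes \<open>X\<close> Lindelof, so a sequence of open covers is described by
  continuous functions \<open>\<psi> k i\<close>, where \<open>\<psi> k i x < 1\<close> puts \<open>x\<close> into the \<open>i\<close>-th set of the \<open>k\<close>-th
  cover.  Map \<open>x\<close> to the function \<open>f\<^sub>x\<close> with \<open>f\<^sub>x(n)\<close> minimal such that each of the covers
  \<open>0, \<dots>, n\<close> catches \<open>x\<close> with an index at most \<open>f\<^sub>x(n)\<close>.  If \<open>{f\<^sub>x | x \<in> Y}\<close> is not finitely
  dominating, witnessed by \<open>h\<close>, the sets \<open>{x \<in> Y. f\<^sub>x(n) \<le> h(n)}\<close> catch every finite subset of \<open>Y\<close>
  for infinitely many \<open>n\<close>.  The Pytkeev property of \<open>C\<^sub>p(Y)\<close> then yields countably many infinite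
  \<open>J\<^sub>j \<subseteq> \<nat>\<close> such that every \<open>x \<in> Y\<close> satisfies \<open>f\<^sub>x \<le> h\<close> on some \<open>J\<^sub>j\<close>; as \<open>f\<^sub>x\<close> is monotone,
  the family is bounded.  Now \<open>X\<close> is a union of fewer than \<open>\<dd>\<close> such \<open>Y\<close>, so \<open>{f\<^sub>x | x \<in> X}\<close> is not
  finitely dominating either, hence bounded: this is the Hurewicz property.

  For the Rothberger property, the bound leaves finitely many candidates from each cover.  Partition
  the covers into blocks, the \<open>n\<close>-th of size \<open>n + 1\<close>, and consider the unions of one candidate from
  each member of a block.  They form an \<open>\<omega>\<close>-cover with finitely many sets per block, so an infinite
  subfamily meets infinitely many blocks, and the Pytkeev property lets one choose sets from
  distinct blocks that cover \<open>X\<close>.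
\<close>

section \<open>Finite domination and the cardinal d\<close>

text \<open>A function \<open>h\<close> that no finite maximum dominates lies strictly above each
  such maximum infinitely often. The weak inequality suffices later and also admits
  \<open>F = {}\<close>.\<close>

lemma not_finitely_dominatingE:
  assumes "\<not> finitely_dominating D"
  obtains h where "\<And>F. finite F \<Longrightarrow> F \<subseteq> D \<Longrightarrow> infinite {n. \<forall>f\<in>F. f n \<le> h n}"
proof -
  obtain h where h: "\<And>g. g \<in> maxfin D \<Longrightarrow> infinite {n. g n < h n}"
    using assms unfolding finitely_dominating_def dominating_def le_star_def
    by (metis (no_types, lifting) Collect_cong not_le)
  show thesis
  proof
    fix F assume F: "finite F" "F \<subseteq> D"
    show "infinite {n. \<forall>f\<in>F. f n \<le> h n}"
    proof (cases "F = {}")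
      case False
      then have "(\<lambda>n. Max ((\<lambda>f. f n) ` F)) \<in> maxfin D"
        using F unfolding maxfin_def by blast
      then have "infinite {n. Max ((\<lambda>f. f n) ` F) < h n}" by (rule h)
      moreover have "{n. Max ((\<lambda>f. f n) ` F) < h n} \<subseteq> {n. \<forall>f\<in>F. f n \<le> h n}"
        using F False by (auto simp: less_imp_le)
      ultimately show ?thesis by (rule infinite_super[rotated])
    qed simp
  qed
qed

text \<open>Inserting a point maps \<open>E \<times> S n\<close> onto the sets of size
  \<open>Suc n\<close>, so by induction no \<open>S n\<close> exceeds \<open>E\<close>; the union
  over all sizes is countable.\<close>

lemma card_of_Fpow_infinite_ordLeq:
  fixes E :: "'a set"
  assumes "infinite E"
  shows "|Fpow E| \<le>o |E|"
proof -
  define S where "S n = {F \<in> Fpow E. card F = n}" for n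
  have "|S n| \<le>o |E|" for n
  proof (induction n)
    case 0
    have "S 0 \<subseteq> {{}}" by (auto simp: S_def Fpow_def)
    then have "|S 0| \<le>o |{{}::'a set}|" by (rule card_of_mono1)
    also have "|{{}::'a set}| \<le>o |E|" using assms by (intro card_of_singl_ordLeq) auto
    finally show ?case .
  next
    case (Suc n)
    have "S (Suc n) \<subseteq> (\<lambda>(x, F). insert x F) ` (E \<times> S n)"
      by (auto simp: S_def Fpow_def card_Suc_eq image_iff)
    then have "|S (Suc n)| \<le>o |(\<lambda>(x, F). insert x F) ` (E \<times> S n)|" by (rule card_of_mono1)
    also have "|(\<lambda>(x, F). insert x F) ` (E \<times> S n)| \<le>o |E \<times> S n|" by (rule card_of_image)
    also have "|E \<times> S n| \<le>o |E|"
      by (rule card_of_Sigma_ordLeq_infinite) (use assms Suc in \<open>auto simp: card_of_refl ordIso_imp_ordLeq\<close>)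
    finally show ?case .
  qed
  then have "|\<Union>n. S n| \<le>o |E|"
    using assms by (intro card_of_UNION_ordLeq_infinite) (auto simp: infinite_iff_card_of_nat[symmetric])
  moreover have "(\<Union>n. S n) = Fpow E" by (auto simp: S_def)
  ultimately show ?thesis by simp
qed

text \<open>Closing an infinite family under finite maxima does not raise its cardinality, so a
  dominating closure would have size below d. For finite \<open>E\<close>, the successor of its
  pointwise maximum escapes.\<close>

lemma small_not_finitely_dominating:
  assumes "|E| <o cardinal_d"
  shows "\<not> finitely_dominating E"
proof
  assume "finitely_dominating E"
  then have dom: "dominating (maxfin E)" by (simp add: finitely_dominating_def)
  show False
  proof (cases "finite E")
    case True
    obtain g where "g \<in> maxfin E" and le: "(\<lambda>n. Suc (Max ((\<lambda>f. f n) ` E))) \<le>\<^sup>* g"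
      using dom unfolding dominating_def by blast
    then obtain F where F: "finite F" "F \<noteq> {}" "F \<subseteq> E" "g = (\<lambda>n. Max ((\<lambda>f. f n) ` F))"
      unfolding maxfin_def by blast
    have "g n \<le> Max ((\<lambda>f. f n) ` E)" for n
      unfolding F(4) using F True by (intro Max_mono) auto
    then have "{n. \<not> Suc (Max ((\<lambda>f. f n) ` E)) \<le> g n} = UNIV"
      by (auto simp: not_less_eq_eq)
    then show False using le by (simp add: le_star_def)
  next
    case False
    have "maxfin E \<subseteq> (\<lambda>F n. Max ((\<lambda>f. f n) ` F)) ` Fpow E"
      by (auto simp: maxfin_def Fpow_def)
    then have "|maxfin E| \<le>o |(\<lambda>F n. Max ((\<lambda>f. f n) ` F)) ` Fpow E|"
      by (rule card_of_mono1)
    also have "|(\<lambda>F n. Max ((\<lambda>f. f n) ` F)) ` Fpow E| \<le>o |Fpow E|"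
      by (rule card_of_image)
    also have "|Fpow E| \<le>o |E|"
      using False by (rule card_of_Fpow_infinite_ordLeq)
    also have "|E| <o cardinal_d" by (rule assms)
    finally have "|maxfin E| <o cardinal_d" .
    moreover have "cardinal_d \<le>o |maxfin E|"
      using min_card_props(2)[OF dominating_families_nonempty] dom
      by (simp add: cardinal_d_def)
    ultimately show False by (simp add: not_ordLess_ordLeq)
  qed
qed

section \<open>The Pytkeev property for indexed families\<close>

text \<open>A basic neighborhood of zero constrains only finitely many points, so vanishing on
  finite sets puts zero into the closure, while \<open>nz\<close> keeps it out of the family itself.
  Testing the resulting sets against the neighborhoods given by a single point yields the last
  conclusion.\<close>

lemma Cp_PytkeevE:
  fixes a :: "'i \<Rightarrow> 'a \<Rightarrow> real"
  assumes pyt: "Cp_Pytkeev Y"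
    and cont: "\<And>i. i \<in> I \<Longrightarrow> continuous_map Y euclideanreal (a i)"
    and nz: "\<And>i. i \<in> I \<Longrightarrow> \<exists>x\<in>topspace Y. a i x \<noteq> 0"
    and zero: "\<And>F. finite F \<Longrightarrow> F \<subseteq> topspace Y \<Longrightarrow> \<exists>i\<in>I. \<forall>x\<in>F. a i x = 0"
  obtains J :: "nat \<Rightarrow> 'i set"
  where "\<And>n. infinite (J n)" "\<And>n. J n \<subseteq> I"
    "\<And>x. x \<in> topspace Y \<Longrightarrow> \<exists>n. \<forall>i\<in>J n. \<bar>a i x\<bar> < 1"
proof -
  define r where "r i = restrict (a i) (topspace Y)" for i
  have r_top: "r ` I \<subseteq> topspace (Cp Y)"
  proof (rule image_subsetI)
    fix i assume "i \<in> I"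
    have "continuous_map Y euclideanreal (r i)"
      by (rule continuous_map_eq[OF cont[OF \<open>i \<in> I\<close>]]) (simp add: r_def)
    then show "r i \<in> topspace (Cp Y)" by (simp add: topspace_Cp r_def)
  qed
  have "Cp_zero Y \<notin> r ` I"
  proof
    assume "Cp_zero Y \<in> r ` I"
    then obtain i where i: "i \<in> I" "Cp_zero Y = r i" by blast
    obtain x where "x \<in> topspace Y" "a i x \<noteq> 0" using nz i by blast
    then show False using fun_cong[OF i(2), of x] by (simp add: r_def Cp_zero_def)
  qed
  moreover have "Cp_zero Y \<in> Cp Y closure_of (r ` I)"
    unfolding in_closure_of
  proof (intro conjI allI impI)
    show "Cp_zero Y \<in> topspace (Cp Y)" by (rule Cp_zero_in_topspace)
    fix T assume T: "Cp_zero Y \<in> T \<and> openin (Cp Y) T"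
    then obtain T' where T': "openin (product_topology (\<lambda>_. euclideanreal) (topspace Y)) T'"
      "T = T' \<inter> {f. continuous_map Y euclideanreal f}"
      unfolding Cp_def openin_subtopology by blast
    then obtain U where U: "finite {x \<in> topspace Y. U x \<noteq> UNIV}"
      "Cp_zero Y \<in> Pi\<^sub>E (topspace Y) U" "Pi\<^sub>E (topspace Y) U \<subseteq> T'"
      using T unfolding openin_product_topology_alt by force
    obtain i where i: "i \<in> I" "\<And>x. x \<in> topspace Y \<Longrightarrow> U x \<noteq> UNIV \<Longrightarrow> a i x = 0"
      using zero[OF U(1)] by auto
    have "r i \<in> Pi\<^sub>E (topspace Y) U"
    proof (rule PiE_I)
      fix x assume x: "x \<in> topspace Y"
      then have "0 \<in> U x" using U(2) by (force simp: Cp_zero_def PiE_iff)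
      then show "r i x \<in> U x" using i(2)[OF x] x by (cases "U x = UNIV") (auto simp: r_def)
    qed (simp add: r_def)
    then have "r i \<in> T"
      using U(3) T'(2) r_top i(1) by (auto simp: topspace_Cp)
    then show "\<exists>y. y \<in> r ` I \<and> y \<in> T" using i(1) by blast
  qed
  ultimately have "Cp_zero Y \<in> Cp Y closure_of (r ` I) - r ` I" by blast
  then obtain B :: "nat \<Rightarrow> ('a \<Rightarrow> real) set" where
    B: "\<And>n. infinite (B n)" "\<And>n. B n \<subseteq> r ` I"
      "\<And>W. openin (Cp Y) W \<Longrightarrow> Cp_zero Y \<in> W \<Longrightarrow> \<exists>n. B n \<subseteq> W"
    using pyt[unfolded Cp_Pytkeev_def, rule_format, OF r_top] by meson
  show thesis
  proof
    fix n
    \<comment> \<open>Different indices may give the same function, but an infinite image still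
      forces an infinite index set.\<close>
    have "r ` {i \<in> I. r i \<in> B n} = B n" using B(2)[of n] by blast
    then show "infinite {i \<in> I. r i \<in> B n}" using B(1)[of n] by (metis finite_imageI)
    show "{i \<in> I. r i \<in> B n} \<subseteq> I" by blast
  next
    fix x assume x: "x \<in> topspace Y"
    have "continuous_map (Cp Y) euclideanreal (\<lambda>f. f x)"
      unfolding Cp_def using x
      by (intro continuous_map_from_subtopology continuous_map_product_projection)
    then have "openin (Cp Y) {f \<in> topspace (Cp Y). f x \<in> {-1<..<1}}"
      by (rule openin_continuous_map_preimage) simp
    moreover have "Cp_zero Y \<in> {f \<in> topspace (Cp Y). f x \<in> {-1<..<1}}"
      using Cp_zero_in_topspace[of Y] x by (simp add: Cp_zero_def)
    ultimately obtain n where "B n \<subseteq> {f \<in> topspace (Cp Y). f x \<in> {-1<..<1}}"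
      using B(3) by blast
    then have "\<bar>a i x\<bar> < 1" if "r i \<in> B n" for i
      using that x by (force simp: r_def)
    then show "\<exists>n. \<forall>i\<in>{i \<in> I. r i \<in> B n}. \<bar>a i x\<bar> < 1" by blast
  qed
qed

section \<open>The Lindelof property and countable functional covers\<close>

text \<open>The Pytkeev property is applied to functions equal to 1 off a finite union of cover
  members. A point where such a function is below 1 lies in that union, so one function from each of
  countably many sets gives a countable subcover.\<close>

lemma Cp_Pytkeev_imp_Lindelof_space:
  assumes cr: "completely_regular_space X" and pyt: "Cp_Pytkeev X"
  shows "Lindelof_space X"
  unfolding Lindelof_space_def
proof (intro allI impI)
  fix \<U> assume "(\<forall>U\<in>\<U>. openin X U) \<and> \<Union>\<U> = topspace X"
  then have \<U>: "\<And>U. U \<in> \<U> \<Longrightarrow> openin X U" "\<Union>\<U> = topspace X" by auto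
  show "\<exists>\<V>. countable \<V> \<and> \<V> \<subseteq> \<U> \<and> \<Union>\<V> = topspace X"
  proof (cases "\<exists>\<F>\<subseteq>\<U>. finite \<F> \<and> \<Union>\<F> = topspace X")
    case True
    then show ?thesis by (meson countable_finite)
  next
    case False
    define I where "I = {f. continuous_map X euclideanreal f \<and>
      (\<exists>\<F>\<subseteq>\<U>. finite \<F> \<and> (\<forall>x\<in>topspace X - \<Union>\<F>. f x = (1::real)))}"
    obtain J :: "nat \<Rightarrow> ('a \<Rightarrow> real) set"
      where J: "\<And>n. infinite (J n)" "\<And>n. J n \<subseteq> I"
        "\<And>x. x \<in> topspace X \<Longrightarrow> \<exists>n. \<forall>f\<in>J n. \<bar>f x\<bar> < 1"
    proof (rule Cp_PytkeevE[OF pyt, of I "\<lambda>f. f"])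
      fix f assume "f \<in> I"
      then show "continuous_map X euclideanreal f" by (simp add: I_def)
      obtain \<F> where F: "\<F> \<subseteq> \<U>" "finite \<F>" "\<forall>x\<in>topspace X - \<Union>\<F>. f x = 1"
        using \<open>f \<in> I\<close> unfolding I_def by blast
      have "\<Union>\<F> \<noteq> topspace X" using False F(1,2) by meson
      moreover have "\<Union>\<F> \<subseteq> topspace X" using F(1) \<U>(2) by blast
      ultimately obtain x where "x \<in> topspace X - \<Union>\<F>" by auto
      then show "\<exists>x\<in>topspace X. f x \<noteq> 0" using F(3) by (metis Diff_iff zero_neq_one)
    next
      fix F assume F: "finite F" "F \<subseteq> topspace X"
      have "\<exists>U f. U \<in> \<U> \<and> continuous_map X euclideanreal f \<and> f x = 0 \<and>
        (\<forall>y\<in>topspace X - U. f y = (1::real))" if "x \<in> F" for x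
      proof -
        obtain U where U: "U \<in> \<U>" "x \<in> U" using F(2) \<U>(2) \<open>x \<in> F\<close> by blast
        have "closedin X (topspace X - U)" using \<U>(1) U by blast
        moreover have "x \<in> topspace X - (topspace X - U)" using U \<open>x \<in> F\<close> F by blast
        ultimately obtain f where "continuous_map X (top_of_set {0..1}) f" "f x = (0::real)"
          "f ` (topspace X - U) \<subseteq> {1}"
          using cr unfolding completely_regular_space_def by metis
        then show ?thesis using U
          by (metis continuous_map_in_subtopology image_subset_iff singletonD)
      qed
      then obtain U f where Uf: "\<And>x. x \<in> F \<Longrightarrow> U x \<in> \<U>"
        "\<And>x. x \<in> F \<Longrightarrow> continuous_map X euclideanreal (f x)"
        "\<And>x. x \<in> F \<Longrightarrow> f x x = 0"
        "\<And>x y. x \<in> F \<Longrightarrow> y \<in> topspace X - U x \<Longrightarrow> f x y = (1::real)"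
        by metis
      \<comment> \<open>The product vanishes wherever one factor does, hence on \<open>F\<close>,
        and stays 1 outside all the \<open>U x\<close>.\<close>
      have "(\<lambda>y. \<Prod>x\<in>F. f x y) \<in> I"
        unfolding I_def mem_Collect_eq
      proof (intro conjI exI[of _ "U ` F"])
        show "continuous_map X euclideanreal (\<lambda>y. \<Prod>x\<in>F. f x y)"
          using F Uf by (intro continuous_map_prod)
        show "\<forall>y\<in>topspace X - \<Union>(U ` F). (\<Prod>x\<in>F. f x y) = 1"
          using Uf(4) by (auto intro!: prod.neutral)
      qed (use F Uf in auto)
      moreover have "\<forall>y\<in>F. (\<Prod>x\<in>F. f x y) = 0"
        using F Uf(3) by (auto simp: prod_zero_iff)
      ultimately show "\<exists>f\<in>I. \<forall>x\<in>F. f x = 0"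
        by (intro bexI[of _ "\<lambda>y. \<Prod>x\<in>F. f x y"])
    qed (rule that)
    have "\<exists>f. f \<in> J n" for n using J(1)[of n] by (metis ex_in_conv finite.emptyI)
    then obtain f where f: "\<And>n. f n \<in> J n" by metis
    then have "f n \<in> I" for n using J(2) by blast
    then have "\<exists>\<F>\<subseteq>\<U>. finite \<F> \<and> (\<forall>x\<in>topspace X - \<Union>\<F>. f n x = 1)" for n
      by (simp add: I_def)
    then obtain \<F> where F: "\<And>n. \<F> n \<subseteq> \<U>" "\<And>n. finite (\<F> n)"
      "\<And>n x. x \<in> topspace X - \<Union>(\<F> n) \<Longrightarrow> f n x = 1"
      by metis
    have "topspace X \<subseteq> \<Union>(\<Union>n. \<F> n)"
    proof
      fix x assume x: "x \<in> topspace X"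
      then obtain n where "\<bar>f n x\<bar> < 1" using J(3) f by blast
      then have "x \<in> \<Union>(\<F> n)" using F(3)[of x n] x by fastforce
      then show "x \<in> \<Union>(\<Union>n. \<F> n)" by blast
    qed
    moreover have "\<Union>(\<Union>n. \<F> n) \<subseteq> topspace X" using F(1) \<U>(2) by blast
    moreover have "countable (\<Union>n. \<F> n)" using F(2) by (simp add: countable_finite)
    moreover have "(\<Union>n. \<F> n) \<subseteq> \<U>" using F(1) by blast
    ultimately show ?thesis by (intro exI[of _ "\<Union>n. \<F> n"] conjI equalityI)
  qed
qed

text \<open>The Lindelof property is applied to the sets where a separating function is below 1/4,
  not to the given cover; this selects countably many functions, each carrying its own cover
  member.\<close>

lemma Lindelof_functional_cover:
  assumes cr: "completely_regular_space X" and lin: "Lindelof_space X"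
    and ne: "topspace X \<noteq> {}"
    and op: "\<And>U. U \<in> \<U> \<Longrightarrow> openin X U" and un: "\<Union>\<U> = topspace X"
  obtains U :: "nat \<Rightarrow> 'a set" and \<psi> :: "nat \<Rightarrow> 'a \<Rightarrow> real"
  where "\<And>i. U i \<in> \<U>" "\<And>i. continuous_map X euclideanreal (\<psi> i)"
    "\<And>i x. x \<in> topspace X - U i \<Longrightarrow> \<psi> i x = 1"
    "\<And>x. x \<in> topspace X \<Longrightarrow> \<exists>i. \<psi> i x \<le> 1/4"
proof -
  define \<Phi> where "\<Phi> = {f. continuous_map X euclideanreal f \<and>
    (\<exists>U\<in>\<U>. \<forall>y\<in>topspace X - U. f y = (1::real))}"
  define S where "S f = {x \<in> topspace X. f x \<in> {..<1/4}}" for f :: "'a \<Rightarrow> real"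
  have opS: "openin X (S f)" if "f \<in> \<Phi>" for f
    unfolding S_def using that
    by (intro openin_continuous_map_preimage[where Y = euclideanreal]) (auto simp: \<Phi>_def)
  have "topspace X \<subseteq> \<Union>(S ` \<Phi>)"
  proof
    fix x assume x: "x \<in> topspace X"
    then obtain U where U: "U \<in> \<U>" "x \<in> U" using un by blast
    have "closedin X (topspace X - U)" using op U by blast
    moreover have "x \<in> topspace X - (topspace X - U)" using U x by blast
    ultimately obtain f where f: "continuous_map X (top_of_set {0..1}) f" "f x = (0::real)"
      "f ` (topspace X - U) \<subseteq> {1}"
      using cr unfolding completely_regular_space_def by metis
    then have "f \<in> \<Phi>" using U(1) unfolding \<Phi>_def
      by (auto simp: continuous_map_in_subtopology)
    moreover have "x \<in> S f" using x f(2) by (simp add: S_def)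
    ultimately show "x \<in> \<Union>(S ` \<Phi>)" by blast
  qed
  then have "\<Union>(S ` \<Phi>) = topspace X" by (auto simp: S_def)
  then obtain \<V> where V: "countable \<V>" "\<V> \<subseteq> S ` \<Phi>" "\<Union>\<V> = topspace X"
    using Lindelof_spaceD[OF lin, of "S ` \<Phi>"] opS by (metis imageE)
  then obtain \<Phi>' where P: "countable \<Phi>'" "\<Phi>' \<subseteq> \<Phi>" "\<V> = S ` \<Phi>'"
    by (meson countable_subset_image)
  have "\<Phi>' \<noteq> {}" using P(3) V(3) ne by (metis Union_empty image_empty)
  \<comment> \<open>Since the space is nonempty, so is \<open>\<Phi>'\<close>, and it can be
    enumerated by all of the naturals, possibly with repetitions.\<close>
  define \<psi> where "\<psi> = from_nat_into \<Phi>'"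
  have rng: "range \<psi> = \<Phi>'" unfolding \<psi>_def using P(1) \<open>\<Phi>' \<noteq> {}\<close> by (simp add: range_from_nat_into)
  then have "\<psi> i \<in> \<Phi>" for i using P(2) by blast
  then have "continuous_map X euclideanreal (\<psi> i)"
    "\<exists>U\<in>\<U>. \<forall>y\<in>topspace X - U. \<psi> i y = 1" for i
    by (auto simp: \<Phi>_def)
  moreover from this obtain U where "\<And>i. U i \<in> \<U>" "\<And>i y. y \<in> topspace X - U i \<Longrightarrow> \<psi> i y = 1"
    by metis
  moreover have "\<exists>i. \<psi> i x \<le> 1/4" if x: "x \<in> topspace X" for x
  proof -
    obtain f where "f \<in> \<Phi>'" "x \<in> S f" using V(3) P(3) x by blast
    moreover then obtain i where "f = \<psi> i" using rng by blast
    ultimately show ?thesis by (auto simp: S_def intro!: exI[of _ i] less_imp_le)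
  qed
  ultimately show thesis using that by blast
qed

text \<open>
  Exact vanishing of a function is not preserved by \<open>Cp_PytkeevE\<close>, which only returns values
  below 1.  The ramp turns this loss into a passage from a threshold \<open>s\<close> to a larger threshold \<open>t\<close>.
\<close>
definition ramp :: "real \<Rightarrow> real \<Rightarrow> real \<Rightarrow> real" where
  "ramp s t r = max 0 (min 1 ((r - s) / (t - s)))"

lemma ramp_bounds: "0 \<le> ramp s t r" "ramp s t r \<le> 1"
  by (auto simp: ramp_def)

lemma ramp_eq_0: "s < t \<Longrightarrow> r \<le> s \<Longrightarrow> ramp s t r = 0"
  by (simp add: ramp_def divide_nonpos_pos min.coboundedI2)

lemma ramp_less_1D: "s < t \<Longrightarrow> ramp s t r < 1 \<Longrightarrow> r < t"
  by (rule ccontr) (simp add: ramp_def not_less)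

lemma continuous_map_ramp:
  assumes "continuous_map Y euclideanreal f"
  shows "continuous_map Y euclideanreal (\<lambda>x. ramp s t (f x))"
  unfolding ramp_def divide_inverse using assms
  by (intro continuous_intros) auto

lemma prod_ramp_less_1D:
  assumes "s < t" and "(\<Prod>i\<in>A. ramp s t (f i)) < 1"
  shows "\<exists>i\<in>A. f i < t"
proof (rule ccontr)
  assume "\<not> ?thesis"
  then have "ramp s t (f i) = 1" if "i \<in> A" for i
    using that ramp_less_1D[OF \<open>s < t\<close>, of "f i"] ramp_bounds(2)[of s t "f i"] by fastforce
  then have "(\<Prod>i\<in>A. ramp s t (f i)) = 1" by (rule prod.neutral[rule_format])
  then show False using assms by simp
qed

section \<open>From infinitely often to eventually: the Hurewicz bound\<close>

text \<open>The Pytkeev property replaces infinite sets depending on a finite set of points by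
  countably many infinite sets, one of which works for each point. Gaps in them are bridged by
  monotonicity in \<open>n\<close>, and countably many bounds are combined by
  diagonalization.\<close>

lemma Cp_Pytkeev_bounded:
  fixes \<psi> :: "nat \<Rightarrow> nat \<Rightarrow> 'a \<Rightarrow> real" and h :: "nat \<Rightarrow> nat"
  assumes pyt: "Cp_Pytkeev Y" and st: "s < t"
    and cont: "\<And>k i. continuous_map Y euclideanreal (\<psi> k i)"
    and inf: "\<And>F. finite F \<Longrightarrow> F \<subseteq> topspace Y \<Longrightarrow>
      infinite {n. \<forall>x\<in>F. \<forall>k\<le>n. \<exists>i\<le>h n. \<psi> k i x \<le> s}"
  obtains b :: "nat \<Rightarrow> nat"
  where "\<And>x. x \<in> topspace Y \<Longrightarrow> \<forall>\<^sub>F n in sequentially. \<forall>k\<le>n. \<exists>i\<le>b n. \<psi> k i x \<le> t"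
proof -
  \<comment> \<open>The sum of nonnegative terms encodes "for all \<open>k\<close>", the product
    encodes "for some \<open>i\<close>".\<close>
  define a where "a n x = (\<Sum>k\<le>n. \<Prod>i\<le>h n. ramp s t (\<psi> k i x))" for n x
  have cont_a: "continuous_map Y euclideanreal (a n)" for n
    unfolding a_def
    by (intro continuous_map_sum continuous_map_prod continuous_map_ramp cont) auto
  have a0: "a n x = 0" if z: "\<forall>k\<le>n. \<exists>i\<le>h n. \<psi> k i x \<le> s" for n x
    unfolding a_def
  proof (rule sum.neutral, rule ballI)
    fix k assume "k \<in> {..n}"
    then obtain i where "i \<le> h n" "\<psi> k i x \<le> s" using z by auto
    then show "(\<Prod>i\<le>h n. ramp s t (\<psi> k i x)) = 0"
      using ramp_eq_0[OF st] by (auto simp: prod_zero_iff)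
  qed
  have a1: "\<forall>k\<le>n. \<exists>i\<le>h n. \<psi> k i x \<le> t" if "\<bar>a n x\<bar> < 1" for n x
  proof (intro allI impI)
    fix k assume "k \<le> n"
    then have "(\<Prod>i\<le>h n. ramp s t (\<psi> k i x)) \<le> a n x"
      unfolding a_def by (intro member_le_sum prod_nonneg) (auto simp: ramp_bounds)
    with that have "(\<Prod>i\<le>h n. ramp s t (\<psi> k i x)) < 1" by linarith
    then show "\<exists>i\<le>h n. \<psi> k i x \<le> t"
      using prod_ramp_less_1D[OF st, of "\<lambda>i. \<psi> k i x" "{..h n}"] by (auto intro: less_imp_le)
  qed
  \<comment> \<open>the functions that vanish identically must be removed before the Pytkeev property applies\<close>
  define I where "I = {n. \<exists>x\<in>topspace Y. a n x \<noteq> 0}"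
  obtain J :: "nat \<Rightarrow> nat set" where J: "\<And>j. infinite (J j)"
    "\<And>x. x \<in> topspace Y \<Longrightarrow> \<exists>j. \<forall>n\<in>J j. \<bar>a n x\<bar> < 1"
  \<comment> \<open>If only finitely many \<open>n\<close> are removed, the infinite sets in
    \<open>inf\<close> still meet \<open>I\<close>. Otherwise \<open>- I\<close> is itself an
    infinite set that works for every point.\<close>
  proof (cases "finite (- I)")
    case True
    have "\<exists>n\<in>I. \<forall>x\<in>F. a n x = 0" if "finite F" "F \<subseteq> topspace Y" for F
    proof -
      have "\<not> {n. \<forall>x\<in>F. \<forall>k\<le>n. \<exists>i\<le>h n. \<psi> k i x \<le> s} \<subseteq> - I"
        using inf[OF that] True finite_subset by blast
      then show ?thesis using a0 by blast
    qed
    note zero = this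
    show thesis
    proof (rule Cp_PytkeevE[OF pyt, of I a])
      fix n assume "n \<in> I"
      then show "\<exists>x\<in>topspace Y. a n x \<noteq> 0" by (simp add: I_def)
    qed (rule cont_a, rule zero, assumption+, rule that, assumption+)
  next
    case False
    show thesis by (rule that[of "\<lambda>_. - I"]) (use False in \<open>auto simp: I_def\<close>)
  qed
  \<comment> \<open>The bound at the next element of \<open>J j\<close> also works at
    \<open>n\<close>, because a statement about all \<open>k\<close> up to that element includes all
    \<open>k\<close> up to \<open>n\<close>.\<close>
  define nxt where "nxt j n = (LEAST m. m \<in> J j \<and> n \<le> m)" for j n
  have nxt: "nxt j n \<in> J j" "n \<le> nxt j n" for j n
  proof -
    have "\<exists>m. m \<in> J j \<and> n \<le> m" using J(1)[of j] by (meson infinite_nat_iff_unbounded_le)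
    from LeastI_ex[OF this] show "nxt j n \<in> J j" "n \<le> nxt j n"
      unfolding nxt_def by auto
  qed
  \<comment> \<open>A diagonal bound: from \<open>n = j\<close> on it takes the set
    \<open>J j\<close> into account.\<close>
  define b where "b n = Max ((\<lambda>j. h (nxt j n)) ` {..n})" for n
  show thesis
  proof
    fix x assume "x \<in> topspace Y"
    then obtain j where j: "\<And>n. n \<in> J j \<Longrightarrow> \<bar>a n x\<bar> < 1" using J(2) by blast
    show "\<forall>\<^sub>F n in sequentially. \<forall>k\<le>n. \<exists>i\<le>b n. \<psi> k i x \<le> t"
      unfolding eventually_sequentially
    proof (rule exI[of _ j], intro allI impI)
      fix n k assume "j \<le> n" "k \<le> n"
      then have "h (nxt j n) \<le> b n" unfolding b_def by (intro Max_ge) auto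
      moreover have "k \<le> nxt j n" using \<open>k \<le> n\<close> nxt(2)[of n j] by linarith
      ultimately show "\<exists>i\<le>b n. \<psi> k i x \<le> t"
        using a1[OF j[OF nxt(1)]] order_trans by meson
    qed
  qed
qed

text \<open>\<open>Cp_Pytkeev_bounded\<close> is used twice, once on each piece of the space and
  once to merge the pieces. Each use raises the threshold, from 1/4 through 1/2 to 3/4.\<close>

lemma Hurewicz_bound:
  fixes X :: "'a topology" and \<psi> :: "nat \<Rightarrow> nat \<Rightarrow> 'a \<Rightarrow> real"
  assumes card: "cov_D_fin <o cardinal_d"
    and pyt: "\<And>Y. Y \<subseteq> topspace X \<Longrightarrow> Cp_Pytkeev (subtopology X Y)"
    and cont: "\<And>k i. continuous_map X euclideanreal (\<psi> k i)"
    and cover: "\<And>k x. x \<in> topspace X \<Longrightarrow> \<exists>i. \<psi> k i x \<le> 1/4"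
  obtains b :: "nat \<Rightarrow> nat"
  where "\<And>x. x \<in> topspace X \<Longrightarrow> \<forall>\<^sub>F n in sequentially. \<exists>i\<le>b n. \<psi> n i x \<le> 3/4"
proof -
  define f where "f x n = (LEAST m. \<forall>k\<le>n. \<exists>i\<le>m. \<psi> k i x \<le> 1/4)" for x n
  have f: "\<forall>k\<le>n. \<exists>i\<le>f x n. \<psi> k i x \<le> 1/4" if x: "x \<in> topspace X" for x n
  proof -
    obtain c where c: "\<And>k. \<psi> k (c k) x \<le> 1/4" using cover[OF x] by metis
    have "\<forall>k\<le>n. \<exists>i\<le>Max (c ` {..n}). \<psi> k i x \<le> 1/4"
      using c by (auto intro!: exI[of _ "c _"] Max_ge)
    then show ?thesis unfolding f_def by (rule LeastI)
  qed
  obtain \<F> where F: "\<F> \<subseteq> D_fin" "\<Union>\<F> = UNIV" "cov_D_fin = |\<F>|"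
    using min_card_props(1)[OF D_fin_covers_nonempty] unfolding cov_D_fin_def
    by (elim bexE CollectE conjE)
  define bd where "bd D b \<longleftrightarrow> (\<forall>x\<in>topspace X. f x \<in> D \<longrightarrow>
    (\<forall>\<^sub>F n in sequentially. \<forall>k\<le>n. \<exists>i\<le>b n. \<psi> k i x \<le> 1/2))" for D b
  have "\<exists>b. bd D b" if D: "D \<in> \<F>" for D
  proof -
    obtain h where h: "\<And>G. finite G \<Longrightarrow> G \<subseteq> D \<Longrightarrow> infinite {n. \<forall>g\<in>G. g n \<le> h n}"
      by (rule not_finitely_dominatingE[of D]) (use D F(1) in \<open>auto simp: D_fin_def\<close>)
    define Y where "Y = {x \<in> topspace X. f x \<in> D}"
    have top: "topspace (subtopology X Y) = Y" by (auto simp: Y_def)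
    obtain b where "\<And>x. x \<in> topspace (subtopology X Y) \<Longrightarrow>
      \<forall>\<^sub>F n in sequentially. \<forall>k\<le>n. \<exists>i\<le>b n. \<psi> k i x \<le> 1/2"
    proof (rule Cp_Pytkeev_bounded[of "subtopology X Y" "1/4" "1/2" \<psi> h])
      show "Cp_Pytkeev (subtopology X Y)" by (rule pyt) (simp add: Y_def)
      show "continuous_map (subtopology X Y) euclideanreal (\<psi> k i)" for k i
        by (intro continuous_map_from_subtopology cont)
      fix G assume G: "finite G" "G \<subseteq> topspace (subtopology X Y)"
      have "infinite {n. \<forall>g\<in>f ` G. g n \<le> h n}"
        using G by (intro h) (auto simp: Y_def)
      moreover have "{n. \<forall>g\<in>f ` G. g n \<le> h n} \<subseteq>
        {n. \<forall>x\<in>G. \<forall>k\<le>n. \<exists>i\<le>h n. \<psi> k i x \<le> 1/4}"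
      proof clarify
        fix n x k assume le: "\<forall>g\<in>f ` G. g n \<le> h n" and x: "x \<in> G" and "k \<le> n"
        have "x \<in> topspace X" using x G(2) by auto
        then obtain i where "i \<le> f x n" "\<psi> k i x \<le> 1/4" using f \<open>k \<le> n\<close> by blast
        moreover have "f x n \<le> h n" using le x by blast
        ultimately show "\<exists>i\<le>h n. \<psi> k i x \<le> 1/4" using order_trans by blast
      qed
      ultimately show "infinite {n. \<forall>x\<in>G. \<forall>k\<le>n. \<exists>i\<le>h n. \<psi> k i x \<le> 1/4}"
        by (rule infinite_super[rotated])
    qed (simp, rule that)
    then show ?thesis unfolding top by (intro exI[of _ b]) (simp add: Y_def bd_def)
  qed
  then obtain b where "\<And>D. D \<in> \<F> \<Longrightarrow> bd D (b D)" by metis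
  then have b: "D \<in> \<F> \<Longrightarrow> x \<in> topspace X \<Longrightarrow> f x \<in> D \<Longrightarrow>
    \<forall>\<^sub>F n in sequentially. \<forall>k\<le>n. \<exists>i\<le>b D n. \<psi> k i x \<le> 1/2" for D x
    by (simp add: bd_def)
  \<comment> \<open>There is one bound per member of a minimal cover, hence fewer than d of them,
    and some \<open>h\<close> lies above any finitely many of them simultaneously infinitely
    often.\<close>
  have small: "|b ` \<F>| <o cardinal_d"
    using ordLeq_ordLess_trans[OF card_of_image card[unfolded F(3)]] .
  obtain h where h: "\<And>G. finite G \<Longrightarrow> G \<subseteq> b ` \<F> \<Longrightarrow> infinite {n. \<forall>g\<in>G. g n \<le> h n}"
    by (rule not_finitely_dominatingE[OF small_not_finitely_dominating[OF small]]) (rule that)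
  have "\<exists>D. f x \<in> D \<and> D \<in> \<F>" for x using F(2) by blast
  then obtain d where d: "\<And>x. f x \<in> d x" "\<And>x. d x \<in> \<F>" by metis
  obtain c where c: "\<And>x. x \<in> topspace X \<Longrightarrow>
    \<forall>\<^sub>F n in sequentially. \<forall>k\<le>n. \<exists>i\<le>c n. \<psi> k i x \<le> 3/4"
  proof (rule Cp_Pytkeev_bounded[of X "1/2" "3/4" \<psi> h])
    show "Cp_Pytkeev X" using pyt[of "topspace X"] by simp
    fix G assume G: "finite G" "G \<subseteq> topspace X"
    have "\<forall>\<^sub>F n in sequentially. \<forall>x\<in>G. \<forall>k\<le>n. \<exists>i\<le>b (d x) n. \<psi> k i x \<le> 1/2"
      using G b d by (intro eventually_ball_finite) auto
    then obtain N where N: "\<And>n x k. n \<ge> N \<Longrightarrow> x \<in> G \<Longrightarrow> k \<le> n \<Longrightarrow> \<exists>i\<le>b (d x) n. \<psi> k i x \<le> 1/2"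
      unfolding eventually_sequentially by blast
    \<comment> \<open>Below \<open>N\<close> the bounds need not yet hold for the points of
      \<open>G\<close>; deleting this initial segment keeps the set infinite.\<close>
    have "infinite ({n. \<forall>g\<in>(\<lambda>x. b (d x)) ` G. g n \<le> h n} - {..<N})"
      using G d by (intro Diff_infinite_finite h) auto
    moreover have "{n. \<forall>g\<in>(\<lambda>x. b (d x)) ` G. g n \<le> h n} - {..<N} \<subseteq>
      {n. \<forall>x\<in>G. \<forall>k\<le>n. \<exists>i\<le>h n. \<psi> k i x \<le> 1/2}"
    proof (intro subsetI CollectI ballI allI impI)
      fix n x k assume "n \<in> {n. \<forall>g\<in>(\<lambda>x. b (d x)) ` G. g n \<le> h n} - {..<N}"
        and x: "x \<in> G" and "k \<le> n"
      then have le: "\<forall>g\<in>(\<lambda>x. b (d x)) ` G. g n \<le> h n" and "n \<notin> {..<N}" by blast+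
      then obtain i where "i \<le> b (d x) n" "\<psi> k i x \<le> 1/2"
        using N[of n x k] x \<open>k \<le> n\<close> by (auto simp: not_less)
      moreover have "b (d x) n \<le> h n" using le x by blast
      ultimately show "\<exists>i\<le>h n. \<psi> k i x \<le> 1/2" using order_trans by blast
    qed
    ultimately show "infinite {n. \<forall>x\<in>G. \<forall>k\<le>n. \<exists>i\<le>h n. \<psi> k i x \<le> 1/2}"
      by (rule infinite_super[rotated])
  qed (simp, rule cont, rule that)
  show thesis
  proof
    fix x assume "x \<in> topspace X"
    from c[OF this] show "\<forall>\<^sub>F n in sequentially. \<exists>i\<le>c n. \<psi> n i x \<le> 3/4"
      by (rule eventually_mono) blast
  qed
qed

section \<open>From the Hurewicz bound to the Rothberger property\<close>

lemma Hurewicz_bound_imp_Rothberger: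
  fixes X :: "'a topology" and \<psi> :: "nat \<Rightarrow> nat \<Rightarrow> 'a \<Rightarrow> real" and b :: "nat \<Rightarrow> nat"
  assumes pyt: "Cp_Pytkeev X" and st: "s < t"
    and cont: "\<And>k i. continuous_map X euclideanreal (\<psi> k i)"
    and b: "\<And>x. x \<in> topspace X \<Longrightarrow> \<forall>\<^sub>F n in sequentially. \<exists>i\<le>b n. \<psi> n i x \<le> s"
  obtains c where "\<And>x. x \<in> topspace X \<Longrightarrow> \<exists>n. \<psi> n (c n) x < t"
proof -
  define e where "e n i = prod_encode (n, i)" for n i :: nat
  \<comment> \<open>block \<open>n\<close> consists of the covers \<open>e n i\<close> with \<open>i \<le> n\<close>; \<open>C n\<close> are the choices of one candidate each\<close>
  define C where "C n = Pi\<^sub>E {..n} (\<lambda>i. {..b (e n i)})" for n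
  define I where "I = (SIGMA n:UNIV. C n)"
  define a where "a = (\<lambda>(n, u) x. \<Prod>i\<le>n. ramp s t (\<psi> (e n i) (u i) x))"
  have a1: "\<exists>i\<le>n. \<psi> (e n i) (u i) x < t" if "\<bar>a (n, u) x\<bar> < 1" for n u x
  proof -
    have "(\<Prod>i\<le>n. ramp s t (\<psi> (e n i) (u i) x)) < 1" using that by (simp add: a_def)
    from prod_ramp_less_1D[OF st this] show ?thesis by auto
  qed
  obtain N :: "nat \<Rightarrow> nat" and u where N: "inj N"
    and u: "\<And>x. x \<in> topspace X \<Longrightarrow> \<exists>j. \<bar>a (N j, u j) x\<bar> < 1"
  \<comment> \<open>A pair whose function vanishes identically would violate \<open>nz\<close>, but
    it settles the claim alone: block \<open>n\<close> already catches every point, so only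
    \<open>j = 0\<close> matters.\<close>
  proof (cases "\<exists>p\<in>I. \<forall>x\<in>topspace X. a p x = 0")
    case True
    then obtain n u where "\<And>x. x \<in> topspace X \<Longrightarrow> a (n, u) x = 0" by (metis surj_pair)
    then have "\<bar>a (n + 0, u) x\<bar> < 1" if "x \<in> topspace X" for x using that by simp
    then show thesis by (intro that[of "\<lambda>j. n + j" "\<lambda>_. u"]) (simp, blast)
  next
    case False
    obtain J where J: "\<And>j. infinite (J j)" "\<And>j. J j \<subseteq> I"
      "\<And>x. x \<in> topspace X \<Longrightarrow> \<exists>j::nat. \<forall>p\<in>J j. \<bar>a p x\<bar> < 1"
    proof (rule Cp_PytkeevE[OF pyt, of I a])
      fix p assume "p \<in> I"
      show "continuous_map X euclideanreal (a p)"
        unfolding a_def split_beta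
        by (intro continuous_map_prod continuous_map_ramp cont) auto
      show "\<exists>x\<in>topspace X. a p x \<noteq> 0" using False \<open>p \<in> I\<close> by blast
    next
      fix F assume F: "finite F" "F \<subseteq> topspace X"
      have "\<forall>\<^sub>F n in sequentially. \<forall>x\<in>F. \<exists>i\<le>b n. \<psi> n i x \<le> s"
        using F b by (intro eventually_ball_finite) auto
      then obtain M where M: "\<And>n x. n \<ge> M \<Longrightarrow> x \<in> F \<Longrightarrow> \<exists>i\<le>b n. \<psi> n i x \<le> s"
        unfolding eventually_sequentially by blast
      \<comment> \<open>Block \<open>n\<close> must lie beyond \<open>M\<close> and contain enough
        covers to give each point of \<open>F\<close> its own.\<close>
      define n where "n = M + card F"
      obtain v where v: "F \<subseteq> v ` {..n}" if "F \<noteq> {}"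
      proof -
        obtain v where "F = v ` {..<card F}"
          using ex_bij_betw_nat_finite[OF F(1)] by (auto simp: bij_betw_def atLeast0LessThan)
        then show thesis using that[of v] by (force simp: n_def)
      qed
      define w where "w i = (LEAST k. \<psi> (e n i) k (v i) \<le> s)" for i
      \<comment> \<open>Positions not assigned to a point of \<open>F\<close> get candidate 0, which
        is always admissible.\<close>
      define u where "u = (\<lambda>i\<in>{..n}. if v i \<in> F then w i else 0)"
      have M_le: "M \<le> e n i" for i
        unfolding e_def n_def by (rule le_trans[OF le_add1 le_prod_encode_1])
      have w: "\<psi> (e n i) (w i) (v i) \<le> s" "w i \<le> b (e n i)" if vi: "v i \<in> F" for i
      proof -
        obtain k where k: "k \<le> b (e n i)" "\<psi> (e n i) k (v i) \<le> s" using M[OF M_le vi] by blast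
        show "w i \<le> b (e n i)"
          unfolding w_def by (rule order_trans[OF Least_le k(1)]) (rule k(2))
        show "\<psi> (e n i) (w i) (v i) \<le> s"
          unfolding w_def by (rule LeastI) (rule k(2))
      qed
      have "(n, u) \<in> I" using w(2) by (auto simp: I_def C_def u_def)
      moreover have "a (n, u) x = 0" if "x \<in> F" for x
      proof -
        have "x \<in> v ` {..n}" using v \<open>x \<in> F\<close> by (metis empty_iff subsetD)
        then obtain i where i: "i \<le> n" "x = v i" by auto
        then have "ramp s t (\<psi> (e n i) (u i) x) = 0"
          using ramp_eq_0[OF st] w(1)[of i] that by (simp add: u_def)
        then show ?thesis using i by (auto simp: a_def prod_zero_iff)
      qed
      ultimately show "\<exists>p\<in>I. \<forall>x\<in>F. a p x = 0" by blast
    qed (rule that)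
    \<comment> \<open>Each block offers only finitely many choices, so an infinite
      \<open>J j\<close> cannot stay within finitely many blocks.\<close>
    have infJ: "infinite (fst ` J j)" for j
    proof
      assume fin: "finite (fst ` J j)"
      have "J j \<subseteq> (SIGMA n:fst ` J j. C n)" using J(2)[of j] by (force simp: I_def)
      moreover have "finite (SIGMA n:fst ` J j. C n)"
        using fin by (intro finite_SigmaI) (auto simp: C_def intro: finite_PiE)
      ultimately show False using J(1)[of j] finite_subset by blast
    qed
    \<comment> \<open>Strictly increasing block numbers ensure that no cover is asked for two
      different choices.\<close>
    have "\<exists>p. \<forall>j. p j \<in> J j \<and> fst (p j) < fst (p (Suc j))"
    proof (rule dependent_nat_choice)
      show "\<exists>p. p \<in> J 0" using J(1)[of 0] by (metis ex_in_conv finite.emptyI)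
      fix p :: "nat \<times> (nat \<Rightarrow> nat)" and j
      obtain m where "m \<in> fst ` J (Suc j)" "fst p < m"
        using infJ[of "Suc j"] by (meson infinite_nat_iff_unbounded)
      then show "\<exists>q. q \<in> J (Suc j) \<and> fst p < fst q" by blast
    qed
    then obtain p where p: "\<And>j. p j \<in> J j" "\<And>j. fst (p j) < fst (p (Suc j))" by blast
    show thesis
    proof (rule that[of "\<lambda>j. fst (p j)" "\<lambda>j. snd (p j)"])
      show "inj (\<lambda>j. fst (p j))"
        using p(2) by (intro strict_mono_imp_inj_on) (simp add: strict_mono_Suc_iff)
      show "\<exists>j. \<bar>a (fst (p j), snd (p j)) x\<bar> < 1" if "x \<in> topspace X" for x
        using J(3)[OF that] p(1) by (metis prod.collapse)
    qed
  qed
  \<comment> \<open>The index \<open>m\<close> is decoded into block and position. Blocks outside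
    the range of \<open>N\<close> receive arbitrary values.\<close>
  define c where "c m = u (inv N (fst (prod_decode m))) (snd (prod_decode m))" for m
  show thesis
  proof
    fix x assume "x \<in> topspace X"
    then obtain j where "\<bar>a (N j, u j) x\<bar> < 1" using u by blast
    then obtain i where "\<psi> (e (N j) i) (u j i) x < t" using a1 by blast
    moreover have "c (e (N j) i) = u j i" using N by (simp add: c_def e_def)
    ultimately show "\<exists>n. \<psi> n (c n) x < t" by metis
  qed
qed

section \<open>Both selection principles\<close>

theorem theorem13:
  fixes X :: "'a topology"
  assumes "cov_D_fin <o cardinal_d"
    and "Tychonoff_space X"
    and "topspace X \<noteq> {}"
    and "\<And>Y. Y \<subseteq> topspace X \<Longrightarrow> Cp_Pytkeev (subtopology X Y)"
  shows "Ufin X (open_covers X) (gamma_covers X) \<and> S1 (open_covers X) (open_covers X)"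
proof -
  have cr: "completely_regular_space X" using assms(2) by (simp add: Tychonoff_space_def)
  have pyt: "Cp_Pytkeev X" using assms(4)[of "topspace X"] by simp
  define R where "R \<U> U \<psi> \<longleftrightarrow> (\<forall>i. U i \<in> \<U>) \<and> (\<forall>i. continuous_map X euclideanreal (\<psi> i)) \<and>
    (\<forall>i. \<forall>x\<in>topspace X - U i. \<psi> i x = 1) \<and> (\<forall>x\<in>topspace X. \<exists>i. \<psi> i x \<le> 1/4)"
    for \<U> and U :: "nat \<Rightarrow> 'a set" and \<psi> :: "nat \<Rightarrow> 'a \<Rightarrow> real"
  have ex: "\<exists>U \<psi>. R \<U> U \<psi>" if "\<U> \<in> open_covers X" for \<U>
  proof -
    have op: "\<And>U. U \<in> \<U> \<Longrightarrow> openin X U" and un: "\<Union>\<U> = topspace X"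
      using that by (auto simp: open_covers_def is_cover_def)
    show ?thesis
      unfolding R_def
      by (rule Lindelof_functional_cover
            [OF cr Cp_Pytkeev_imp_Lindelof_space[OF cr pyt] assms(3) op un]) blast+
  qed
  \<comment> \<open>Both principles start from the same data: enumerated members of each cover with
    their functions and a Hurewicz bound.\<close>
  have key: thesis
    if \<U>: "\<And>n::nat. \<U> n \<in> open_covers X" and
      thesis: "\<And>U \<psi> b. (\<And>n i. U n i \<in> \<U> n) \<Longrightarrow>
        (\<And>n i. continuous_map X euclideanreal (\<psi> n i)) \<Longrightarrow>
        (\<And>n i x. x \<in> topspace X - U n i \<Longrightarrow> \<psi> n i x = (1::real)) \<Longrightarrow>
        (\<And>x. x \<in> topspace X \<Longrightarrow> \<forall>\<^sub>F n in sequentially. \<exists>i\<le>(b n :: nat). \<psi> n i x \<le> 3/4) \<Longrightarrow>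
        thesis"
    for \<U> thesis
  proof -
    obtain U \<psi> where R: "\<And>n. R (\<U> n) (U n) (\<psi> n)" using ex[OF \<U>] by metis
    obtain b where b: "\<And>x. x \<in> topspace X \<Longrightarrow>
      \<forall>\<^sub>F n in sequentially. \<exists>i\<le>b n. \<psi> n i x \<le> 3/4"
    proof (rule Hurewicz_bound[OF assms(1,4), of \<psi>])
      show "continuous_map X euclideanreal (\<psi> k i)" for k i using R[of k] by (simp add: R_def)
      show "\<exists>i. \<psi> k i x \<le> 1/4" if "x \<in> topspace X" for k x
        using R[of k] that by (simp add: R_def)
    qed (assumption, rule that)
    show thesis
    proof (rule thesis[of U \<psi> b])
      show "U n i \<in> \<U> n" "continuous_map X euclideanreal (\<psi> n i)" for n i
        using R[of n] by (simp_all add: R_def)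
      show "\<psi> n i x = 1" if "x \<in> topspace X - U n i" for n i x
        using R[of n] that by (auto simp: R_def)
    qed (rule b)
  qed
  have "Ufin X (open_covers X) (gamma_covers X)"
    unfolding Ufin_def
  proof (intro allI impI)
    fix \<U> :: "nat \<Rightarrow> 'a set set"
    assume "\<forall>n. \<U> n \<in> open_covers X \<and> \<not> (\<exists>F\<subseteq>\<U> n. finite F \<and> \<Union>F = topspace X)"
    then have \<U>: "\<And>n. \<U> n \<in> open_covers X"
      and nofin: "\<And>n F. F \<subseteq> \<U> n \<Longrightarrow> finite F \<Longrightarrow> \<Union>F \<noteq> topspace X" by auto
    obtain U \<psi> b where U: "\<And>n i. U n i \<in> \<U> n"
      and "\<And>n i. continuous_map X euclideanreal (\<psi> n i)"
      and o: "\<And>n i x. x \<in> topspace X - U n i \<Longrightarrow> \<psi> n i x = (1::real)"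
      and ev: "\<And>x. x \<in> topspace X \<Longrightarrow> \<forall>\<^sub>F n in sequentially. \<exists>i\<le>(b n :: nat). \<psi> n i x \<le> 3/4"
      by (rule key[of \<U>, OF \<U>]) (rule that)
    define V where "V n = \<Union>(U n ` {..b n})" for n
    have opV: "openin X (V n)" for n
      using U \<U> unfolding V_def by (intro openin_Union) (auto simp: open_covers_def)
    have sub: "V n \<subseteq> topspace X" for n by (rule openin_subset[OF opV])
    have neq: "V n \<noteq> topspace X" for n
      unfolding V_def using U by (intro nofin) auto
    have fin: "finite {n. x \<notin> V n}" if x: "x \<in> topspace X" for x
    proof -
      obtain N where N: "\<And>n. n \<ge> N \<Longrightarrow> \<exists>i\<le>b n. \<psi> n i x \<le> 3/4"
        using ev[OF x] unfolding eventually_sequentially by blast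
      have "x \<in> V n" if "n \<ge> N" for n
      proof -
        obtain i where i: "i \<le> b n" "\<psi> n i x \<le> 3/4" using N[OF \<open>n \<ge> N\<close>] by blast
        have "x \<in> U n i" using o[of x n i] i(2) x by fastforce
        then show ?thesis using i(1) by (auto simp: V_def)
      qed
      then have "{n. x \<notin> V n} \<subseteq> {..<N}" by (auto simp: not_le[symmetric])
      then show ?thesis using finite_subset by blast
    qed
    have cov: "\<Union>(range V) = topspace X"
    proof
      show "\<Union>(range V) \<subseteq> topspace X" using sub by blast
      show "topspace X \<subseteq> \<Union>(range V)"
      proof
        fix x assume "x \<in> topspace X"
        then have "{n. x \<notin> V n} \<noteq> UNIV" using fin by (metis infinite_UNIV_nat)
        then show "x \<in> \<Union>(range V)" by blast
      qed
    qed
    \<comment> \<open>Otherwise one set would recur infinitely often. Since each point is missed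
      only finitely often, that set would be the whole space, contrary to the absence of finite
      subcovers.\<close>
    have "infinite (range V)"
    proof
      assume "finite (range V)"
      then obtain n0 where n0: "infinite {n. V n = V n0}"
        using pigeonhole_infinite[of UNIV V] by auto
      have "x \<in> V n0" if "x \<in> topspace X" for x
      proof (rule ccontr)
        assume "x \<notin> V n0"
        then have "{n. V n = V n0} \<subseteq> {n. x \<notin> V n}" by auto
        then show False using fin[OF that] n0 finite_subset by blast
      qed
      then show False using sub[of n0] neq[of n0] by blast
    qed
    moreover have "finite {W \<in> range V. x \<notin> W}" if "x \<in> topspace X" for x
    proof -
      have "{W \<in> range V. x \<notin> W} \<subseteq> V ` {n. x \<notin> V n}" by blast
      then show ?thesis using fin[OF that] finite_subset by blast
    qed
    moreover have "topspace X \<notin> range V" using neq by (metis imageE)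
    ultimately have "range V \<in> gamma_covers X"
      using cov opV by (auto simp: gamma_covers_def open_covers_def is_cover_def)
    then show "\<exists>F. (\<forall>n. finite (F n) \<and> F n \<subseteq> \<U> n) \<and> range (\<lambda>n. \<Union>(F n)) \<in> gamma_covers X"
      using U unfolding V_def by (intro exI[of _ "\<lambda>n. U n ` {..b n}"]) auto
  qed
  moreover have "S1 (open_covers X) (open_covers X)"
    unfolding S1_def
  proof (intro allI impI)
    fix \<U> :: "nat \<Rightarrow> 'a set set"
    assume "\<forall>n. \<U> n \<in> open_covers X"
    then have \<U>: "\<And>n. \<U> n \<in> open_covers X" by auto
    obtain U \<psi> b where U: "\<And>n i. U n i \<in> \<U> n"
      and c: "\<And>n i. continuous_map X euclideanreal (\<psi> n i)"
      and o: "\<And>n i x. x \<in> topspace X - U n i \<Longrightarrow> \<psi> n i x = (1::real)"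
      and ev: "\<And>x. x \<in> topspace X \<Longrightarrow> \<forall>\<^sub>F n in sequentially. \<exists>i\<le>(b n :: nat). \<psi> n i x \<le> 3/4"
      by (rule key[of \<U>, OF \<U>]) (rule that)
    \<comment> \<open>The threshold 1 is the last usable one: a value below 1 still forces
      membership in the cover set.\<close>
    obtain k where k: "\<And>x. x \<in> topspace X \<Longrightarrow> \<exists>n. \<psi> n (k n) x < 1"
      using Hurewicz_bound_imp_Rothberger[OF pyt _ c ev, of 1] by auto
    have "\<exists>n. x \<in> U n (k n)" if "x \<in> topspace X" for x
      using k[OF that] o that by (metis DiffI less_irrefl)
    moreover have "U n (k n) \<subseteq> topspace X" "U n (k n) \<noteq> topspace X" "openin X (U n (k n))" for n
      using U[of n "k n"] \<U>[of n] by (auto simp: open_covers_def is_cover_def)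
    moreover from this(2) have "topspace X \<notin> range (\<lambda>n. U n (k n))" by (metis imageE)
    ultimately have "range (\<lambda>n. U n (k n)) \<in> open_covers X"
      by (auto simp: open_covers_def is_cover_def)
    then show "\<exists>V. (\<forall>n. V n \<in> \<U> n) \<and> range V \<in> open_covers X"
      using U by (intro exI[of _ "\<lambda>n. U n (k n)"]) auto
  qed
  ultimately show ?thesis ..
qed

end
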